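(* In the probabilistic model described in the context, fix an integer $d \geq 0$. Then the sequence $\{ \mathbf{M}_{\mathbf{f},k}(d) \}_{k=2}^{\infty}$ is bounded with probability 1.
   Context: Let $A:\mathbb{N}\to\mathbb{R}_{>0}$ satisfy $A(n)\to\infty$ and $\sum_{n\ge1} A(n)^{-1/2}<\infty$. Let $\{\varepsilon_n\}$ be positive reals with $\varepsilon_n\to0$ and $\varepsilon_n \gg \frac{\log A(n)}{\sqrt{A(n)}}$ as $n\to\infty$ (where $u_n\gg v_n$ means $u_n \ge C v_n$ for some constant $C>0$ and all large $n$). Let $\mathcal{S}_n = \{x\in \mathbb{N} : A(n)(1 - \varepsilon_n) \leq x \leq A(n) (1 + \varepsilon_n) \}$ and let $\mathbf{f}_n$ be a random variable uniformly distributed on $\mathcal{S}_n$. Define $\mathbf{\Delta}_{\mathbf{f},k}(n) := \min \{ | \mathbf{f}_n- m^k| : m \in \mathbb{Z} \}$ and $\mathbf{M}_{\mathbf{f}, k}(d) := \max \{ n \in \mathbb{N} : \mathbf{\Delta}_{\mathbf{f}, k}(n) \leq d \}$, with value $\infty$ if no maximum exists.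
   Formalization: M_{f,k}(d) is taken to be 0, not ∞, when no n satisfies Δ_{f,k}(n) ≤ d; with the value ∞ for the empty set the claim fails (e.g. d = 0 and all f_n ≥ 2, where for large k almost surely no f_n is a k-th power). *)

theory Defs
  imports "HOL-Probability.Probability"
begin

text \<open>The natural numbers of the model start at 1, so \<open>x\<close> and the index \<open>n\<close> below
  are restricted to positive values; the values at index 0 are irrelevant.\<close>

definition sample_set :: "(nat \<Rightarrow> real) \<Rightarrow> (nat \<Rightarrow> real) \<Rightarrow> nat \<Rightarrow> nat set" where
  "sample_set A \<epsilon> n =
     {x. 1 \<le> x \<and> A n * (1 - \<epsilon> n) \<le> real x \<and> real x \<le> A n * (1 + \<epsilon> n)}"

text \<open>On \<open>nat\<close>, the infimum of a nonempty set is its minimum.\<close>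

definition power_dist :: "(nat \<Rightarrow> nat) \<Rightarrow> nat \<Rightarrow> nat \<Rightarrow> nat" where
  "power_dist g k n = (INF m::int. nat \<bar>int (g n) - m ^ k\<bar>)"

text \<open>The value \<open>\<infinity>\<close> stands for the absence of a maximum because there are infinitely many
  such \<open>n\<close>. If there is no such \<open>n\<close> at all, the value is 0, the supremum of the empty set.\<close>

definition max_index :: "(nat \<Rightarrow> nat) \<Rightarrow> nat \<Rightarrow> nat \<Rightarrow> enat" where
  "max_index g k d =
     (let N = {n. 1 \<le> n \<and> power_dist g k n \<le> d}
      in if N = {} then 0 else if finite N then enat (Max N) else \<infinity>)"

end

theory Submission
  imports Defs "HOL-Real_Asymp.Real_Asymp"
begin

text \<open>By Borel--Cantelli it suffices to bound the probability that \<open>f\<^sub>n\<close> lies within \<open>d\<close> of some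
  perfect power by a constant multiple of \<open>A(n)\<^sup>-\<^sup>1\<^sup>/\<^sup>2\<close>. The window around \<open>a = A(n)\<close> has length
  about \<open>\<epsilon>a\<close>. It contains \<open>O(\<epsilon>a\<^sup>1\<^sup>/\<^sup>2 + 1)\<close> squares and, for each of the \<open>O(log a)\<close> relevant exponents
  \<open>k \<ge> 3\<close>, at most \<open>O(\<epsilon>a\<^sup>1\<^sup>/\<^sup>3 + 1)\<close> perfect \<open>k\<close>-th powers. Treating the squares separately keeps the
  logarithm away from the main term \<open>\<epsilon>a\<^sup>1\<^sup>/\<^sup>2\<close>, and the lower bound on \<open>\<epsilon>\<close> absorbs the
  contribution \<open>O(log a)\<close> of the summands \<open>1\<close>.\<close>

text \<open>All exponents are merged into one set, so that a single event per index \<open>n\<close>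
  serves every \<open>k\<close> and the final bound is uniform in \<open>k\<close>.\<close>

definition near_powers :: "nat \<Rightarrow> nat set" where
  "near_powers d = {x. \<exists>k\<ge>2. \<exists>m::int. \<bar>int x - m ^ k\<bar> \<le> int d}"

lemma power_dist_le_iff: "power_dist g k n \<le> d \<longleftrightarrow> (\<exists>m::int. \<bar>int (g n) - m ^ k\<bar> \<le> int d)"
proof
  assume "power_dist g k n \<le> d"
  moreover have "power_dist g k n \<in> range (\<lambda>m::int. nat \<bar>int (g n) - m ^ k\<bar>)"
    unfolding power_dist_def by (rule Inf_nat_def1) auto
  ultimately obtain m :: int where "nat \<bar>int (g n) - m ^ k\<bar> \<le> d"
    by auto
  then show "\<exists>m::int. \<bar>int (g n) - m ^ k\<bar> \<le> int d"
    by (intro exI[of _ m]) linarith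
next
  assume "\<exists>m::int. \<bar>int (g n) - m ^ k\<bar> \<le> int d"
  then obtain m :: int where m: "\<bar>int (g n) - m ^ k\<bar> \<le> int d" ..
  have "power_dist g k n \<le> nat \<bar>int (g n) - m ^ k\<bar>"
    unfolding power_dist_def by (rule cINF_lower) auto
  with m show "power_dist g k n \<le> d"
    by linarith
qed

text \<open>Such a \<open>B\<close> makes the set of qualifying indices finite, which rules out
  \<infinity>; an empty set gives the value 0.\<close>

lemma max_index_le:
  assumes "\<And>n. n \<ge> 1 \<Longrightarrow> power_dist g k n \<le> d \<Longrightarrow> n \<le> B"
  shows "max_index g k d \<le> enat B"
proof -
  let ?N = "{n. 1 \<le> n \<and> power_dist g k n \<le> d}"
  have sub: "?N \<subseteq> {..B}"
    using assms by auto
  then have fin: "finite ?N"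
    by (rule finite_subset) simp
  then show ?thesis
    using sub Max_in[OF fin] by (auto simp: max_index_def Let_def)
qed

section \<open>Counting \<open>k\<close>-th powers in a real interval\<close>

lemma card_le_of_spread:
  fixes M :: "nat set" and D W :: real
  assumes "finite M" "D > 0" "W \<ge> 0"
    and gap: "\<And>m m'. m \<in> M \<Longrightarrow> m' \<in> M \<Longrightarrow> m \<le> m' \<Longrightarrow> (real m' - real m) * D \<le> W"
  shows "real (card M) \<le> W / D + 1"
proof (cases "M = {}")
  case True
  then show ?thesis using assms by simp
next
  case False
  \<comment> \<open>Filling up \<open>M\<close> to a full integer interval reduces the count to the
    spread of its two extreme elements.\<close>
  have "M \<subseteq> {Min M..Max M}"
    using assms(1) by auto
  then have "card M \<le> card {Min M..Max M}"
    by (rule card_mono[rotated]) simp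
  moreover have le: "Min M \<le> Max M"
    using assms(1) False by simp
  ultimately have "real (card M) \<le> real (Max M) - real (Min M) + 1"
    by (simp add: of_nat_diff)
  also have "real (Max M) - real (Min M) \<le> W / D"
    using gap[of "Min M" "Max M"] assms(1,2) False le by (simp add: pos_le_divide_eq)
  finally show ?thesis by simp
qed

lemma power_diff_ge:
  fixes x y :: real
  assumes "0 \<le> x" "x \<le> y" "k \<ge> 1"
  shows "(y - x) * x ^ (k - 1) \<le> y ^ k - x ^ k"
proof -
  obtain j where k: "k = Suc j"
    using assms(3) by (cases k) auto
  have "y * x ^ j \<le> y * y ^ j"
    using assms by (intro mult_left_mono power_mono) auto
  then show ?thesis
    by (simp add: k algebra_simps)
qed

lemma finite_powers_between:
  fixes L U :: real
  assumes "k \<ge> 1"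
  shows "finite {m::nat. L \<le> real m ^ k \<and> real m ^ k \<le> U}"
proof (rule finite_subset)
  show "{m::nat. L \<le> real m ^ k \<and> real m ^ k \<le> U} \<subseteq> {..nat \<lceil>U\<rceil>}"
  proof clarsimp
    fix m :: nat
    assume "real m ^ k \<le> U"
    moreover have "real m \<le> real m ^ k"
      using assms by (cases "m = 0") (auto intro: self_le_power)
    ultimately show "m \<le> nat \<lceil>U\<rceil>"
      by linarith
  qed
qed simp

text \<open>Neighbouring \<open>k\<close>-th powers above \<open>L\<close> differ by at least
  \<open>m ^ (k - 1)\<close>, which is (m^k)^(1 - 1/k) and hence at least \<open>L powr s\<close>
  whenever s \<le> 1 - 1/k. Keeping \<open>s\<close> free allows 1/2 for squares and the common
  value 2/3 for all k \<ge> 3.\<close>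

lemma card_powers_between:
  fixes L U s :: real
  assumes "L \<ge> 1" "L \<le> U" "k \<ge> 1" "0 \<le> s" "s * real k \<le> real k - 1"
  shows "real (card {m::nat. L \<le> real m ^ k \<and> real m ^ k \<le> U}) \<le> (U - L) / L powr s + 1"
proof (rule card_le_of_spread)
  show "finite {m::nat. L \<le> real m ^ k \<and> real m ^ k \<le> U}"
    by (rule finite_powers_between) fact
next
  fix m m' :: nat
  assume m: "m \<in> {m. L \<le> real m ^ k \<and> real m ^ k \<le> U}"
    and m': "m' \<in> {m. L \<le> real m ^ k \<and> real m ^ k \<le> U}" and "m \<le> m'"
  have m1: "m \<ge> 1"
    using m assms(1,3) by (cases "m = 0") (auto simp: power_0_left)
  have "L powr s \<le> (real m ^ k) powr s"
    using m assms by (intro powr_mono2) auto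
  also have "\<dots> = real m powr (s * real k)"
    using m1 by (simp add: powr_powr mult.commute flip: powr_realpow)
  also have "\<dots> \<le> real m powr (real k - 1)"
    using m1 assms by (intro powr_mono) auto
  also have "\<dots> = real m ^ (k - 1)"
    using m1 assms(3) by (simp add: of_nat_diff flip: powr_realpow)
  finally have "(real m' - real m) * L powr s \<le> (real m' - real m) * real m ^ (k - 1)"
    using \<open>m \<le> m'\<close> by (intro mult_left_mono) auto
  also have "\<dots> \<le> real m' ^ k - real m ^ k"
    using \<open>m \<le> m'\<close> assms(3) by (intro power_diff_ge) auto
  also have "\<dots> \<le> U - L"
    using m m' by auto
  finally show "(real m' - real m) * L powr s \<le> U - L" .
qed (use assms in auto)

section \<open>Counting integers close to perfect powers\<close>

lemma near_power_witness:
  assumes "x \<in> near_powers d" "x > d + 1"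
  obtains k m :: nat where "k \<ge> 2" "m \<ge> 2" "\<bar>int x - int m ^ k\<bar> \<le> int d"
proof -
  obtain k and m :: int where km: "k \<ge> 2" "\<bar>int x - m ^ k\<bar> \<le> int d"
    using assms(1) by (auto simp: near_powers_def)
  \<comment> \<open>This excludes bases of absolute value 0 and 1, whose powers stay bounded and so
    would put no limit on the exponent.\<close>
  then have pos: "m ^ k > 1"
    using assms(2) by linarith
  then have eq: "m ^ k = int (nat \<bar>m\<bar>) ^ k"
    by (metis abs_of_pos abs_ge_zero int_nat_eq less_trans power_abs zero_less_one)
  have "nat \<bar>m\<bar> \<noteq> 0" "nat \<bar>m\<bar> \<noteq> 1"
    using pos km(1) unfolding eq by (intro notI; simp add: power_0_left)+
  then show ?thesis
    using that[of k "nat \<bar>m\<bar>"] km eq by simp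
qed

text \<open>A union bound: at most log 2 (u + d) exponents, the bases whose power lies in the
  interval widened by \<open>d\<close> on both sides, and at most 2d + 1 integers around each
  power.\<close>

lemma card_near_powers_le:
  fixes l u :: real and d :: nat
  assumes l: "l \<ge> real d + 2" and lu: "l \<le> u"
  shows "real (card {x \<in> near_powers d. l \<le> real x \<and> real x \<le> u}) \<le>
    (2 * real d + 1) *
      ((u - l + 2 * real d) / (l - real d) powr (1/2) + 1 +
       log 2 (u + real d) * ((u - l + 2 * real d) / (l - real d) powr (2/3) + 1))"
proof -
  define L U where "L = l - real d" and "U = u + real d"
  define K where "K = nat \<lfloor>log 2 U\<rfloor>"
  define M where "M k = {m::nat. L \<le> real m ^ k \<and> real m ^ k \<le> U}" for k :: nat
  define I where "I m k = {m ^ k - d..m ^ k + d}" for m k :: nat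
  have LU: "L \<ge> 1" "L \<le> U" "U \<ge> 1" "U - L = u - l + 2 * real d"
    using l lu by (auto simp: L_def U_def)
  have fin: "finite (M k)" if "k \<ge> 1" for k
    unfolding M_def by (rule finite_powers_between) fact
  have "{x \<in> near_powers d. l \<le> real x \<and> real x \<le> u} \<subseteq> (\<Union>k\<in>{2..K}. \<Union>m\<in>M k. I m k)"
  proof
    fix x assume x: "x \<in> {x \<in> near_powers d. l \<le> real x \<and> real x \<le> u}"
    have "x > d + 1" using x l by auto
    then obtain k m :: nat where km: "k \<ge> 2" "m \<ge> 2" "\<bar>int x - int m ^ k\<bar> \<le> int d"
      using x near_power_witness[of x d] by blast
    have km': "m ^ k \<le> x + d" "x \<le> m ^ k + d"
      using km(3) by (auto simp flip: of_nat_power)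
    then have mk: "real m ^ k \<le> real x + real d" "real x \<le> real m ^ k + real d"
      by (simp_all flip: of_nat_add of_nat_power)
    then have mM: "m \<in> M k"
      using x by (auto simp: M_def L_def U_def)
    \<comment> \<open>The base is at least 2, so the exponent is at most logarithmic in
      \<open>U\<close>.\<close>
    have "2 ^ k \<le> real m ^ k"
      using km by (intro power_mono) auto
    also have "\<dots> \<le> U" using mM by (simp add: M_def)
    finally have "real k \<le> log 2 U"
      using LU by (simp add: le_log_iff powr_realpow)
    then have "k \<le> K" unfolding K_def by linarith
    moreover have "x \<in> I m k"
      using km' by (auto simp: I_def)
    ultimately show "x \<in> (\<Union>k\<in>{2..K}. \<Union>m\<in>M k. I m k)"
      using km mM by auto
  qed
  then have "card {x \<in> near_powers d. l \<le> real x \<and> real x \<le> u}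
      \<le> card (\<Union>k\<in>{2..K}. \<Union>m\<in>M k. I m k)"
    by (rule card_mono[rotated]) (auto simp: I_def intro!: fin)
  also have "\<dots> \<le> (\<Sum>k\<in>{2..K}. card (\<Union>m\<in>M k. I m k))"
    by (rule card_UN_le) simp
  also have "\<dots> \<le> (\<Sum>k\<in>{2..K}. \<Sum>m\<in>M k. card (I m k))"
    by (intro sum_mono card_UN_le fin) simp
  also have "\<dots> \<le> (\<Sum>k\<in>{2..K}. \<Sum>m\<in>M k. 2 * d + 1)"
    by (intro sum_mono) (auto simp: I_def)
  also have "\<dots> = (2 * d + 1) * (\<Sum>k\<in>{2..K}. card (M k))"
    by (simp add: sum_distrib_left mult.commute)
  \<comment> \<open>Enlarging the index set separates the squares even when K < 2.\<close>
  also have "\<dots> \<le> (2 * d + 1) * (\<Sum>k\<in>insert 2 {3..K}. card (M k))"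
    by (intro mult_left_mono sum_mono2) auto
  also have "\<dots> = (2 * d + 1) * (card (M 2) + (\<Sum>k\<in>{3..K}. card (M k)))"
    by simp
  finally have "real (card {x \<in> near_powers d. l \<le> real x \<and> real x \<le> u})
      \<le> real ((2 * d + 1) * (card (M 2) + (\<Sum>k\<in>{3..K}. card (M k))))"
    by (rule of_nat_mono)
  also have "\<dots> = (2 * real d + 1) * (real (card (M 2)) + (\<Sum>k\<in>{3..K}. real (card (M k))))"
    by (simp add: algebra_simps)
  also have "\<dots> \<le> (2 * real d + 1) *
      ((U - L) / L powr (1/2) + 1 + log 2 U * ((U - L) / L powr (2/3) + 1))"
  proof (intro mult_left_mono add_mono[of "real (card (M 2))"])
    show "real (card (M 2)) \<le> (U - L) / L powr (1/2) + 1"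
      unfolding M_def using LU by (intro card_powers_between) auto
    have "(\<Sum>k\<in>{3..K}. real (card (M k))) \<le> (\<Sum>k\<in>{3..K}. (U - L) / L powr (2/3) + 1)"
      unfolding M_def using LU by (intro sum_mono card_powers_between) auto
    also have "\<dots> = real (K - 2) * ((U - L) / L powr (2/3) + 1)"
      by simp
    also have "\<dots> \<le> log 2 U * ((U - L) / L powr (2/3) + 1)"
    proof (rule mult_right_mono)
      have "log 2 U \<ge> 0" using LU by simp
      then show "real (K - 2) \<le> log 2 U"
        unfolding K_def by linarith
    qed (use LU in auto)
    finally show "(\<Sum>k\<in>{3..K}. real (card (M k))) \<le> log 2 U * ((U - L) / L powr (2/3) + 1)" .
  qed simp
  finally show ?thesis
    unfolding LU(4) by (simp add: L_def U_def)
qed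

section \<open>Density of near powers in the window around \<open>a\<close>\<close>

lemma card_nat_between_ge:
  fixes l u :: real
  assumes "0 < l"
  shows "u - l - 1 \<le> real (card {x::nat. 1 \<le> x \<and> l \<le> real x \<and> real x \<le> u})"
proof -
  have fin: "finite {x::nat. 1 \<le> x \<and> l \<le> real x \<and> real x \<le> u}"
    by (rule finite_subset[of _ "{..nat \<lceil>u\<rceil>}"]) (auto, linarith)
  have "{nat \<lceil>l\<rceil>..<Suc (nat \<lfloor>u\<rfloor>)} \<subseteq> {x::nat. 1 \<le> x \<and> l \<le> real x \<and> real x \<le> u}"
  proof
    fix x assume "x \<in> {nat \<lceil>l\<rceil>..<Suc (nat \<lfloor>u\<rfloor>)}"
    then have "nat \<lceil>l\<rceil> \<le> x" "x \<le> nat \<lfloor>u\<rfloor>" by auto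
    with assms show "x \<in> {x::nat. 1 \<le> x \<and> l \<le> real x \<and> real x \<le> u}"
      by simp linarith
  qed
  then have "card {nat \<lceil>l\<rceil>..<Suc (nat \<lfloor>u\<rfloor>)} \<le> card {x::nat. 1 \<le> x \<and> l \<le> real x \<and> real x \<le> u}"
    by (rule card_mono[OF fin])
  then show ?thesis
    using assms by simp linarith
qed

lemma finite_sample_set: "finite (sample_set A \<epsilon> n)"
  unfolding sample_set_def
  by (rule finite_subset[of _ "{..nat \<lceil>A n * (1 + \<epsilon> n)\<rceil>}"]) (auto, linarith)

text \<open>The count is measured against \<open>a * e\<close>, half the window length, which later
  bounds the sample size from below. Since \<open>e\<close> is quantified inside the eventuality,
  the threshold for \<open>a\<close> does not depend on it, and \<open>e\<close> may vary with
  \<open>n\<close>.\<close>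

lemma near_powers_density:
  fixes C :: real and d :: nat
  assumes "C > 0"
  shows "\<exists>K. \<forall>\<^sub>F a in at_top. \<forall>e. C * (ln a / sqrt a) \<le> e \<longrightarrow> e \<le> 1/4 \<longrightarrow>
    real (card {x \<in> near_powers d. a * (1 - e) \<le> real x \<and> real x \<le> a * (1 + e)})
      \<le> K * a powr (-1/2) * (a * e) \<and> 1 \<le> a * e"
proof -
  define W where "W = 2 * real d + 2"
  \<comment> \<open>The four summands come, in order, from the main term and the summand 1 for
    squares, then from the main term and the summand 1 for higher powers, the last two carrying the
    logarithm.\<close>
  define K where "K = (2 * real d + 1) * (W * 2 + 1 / C + W + 4 / C)"
  \<comment> \<open>The first condition keeps the widened window within [a/2, 2a], the second
    absorbs constants into \<open>ln a\<close>, the third gives 1 \<le> a e, and the fourth lets the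
    gain of 2/3 over 1/2 pay for the logarithm.\<close>
  have ev: "\<forall>\<^sub>F a in at_top. a \<ge> 4 * real d + 8"
           "\<forall>\<^sub>F a in at_top. ln a \<ge> (1::real)"
           "\<forall>\<^sub>F a in at_top. C * ln a \<ge> (1::real)"
           "\<forall>\<^sub>F a in at_top. 4 * ln a / (a / 2) powr (2/3) \<le> a powr (-1/2 :: real)"
    using assms by real_asymp+
  show ?thesis
  proof (intro exI[of _ K], use ev in eventually_elim, intro allI impI)
    fix a e :: real
    assume a: "4 * real d + 8 \<le> a" and ln1: "1 \<le> ln a" and Cln: "1 \<le> C * ln a"
      and ln_small: "4 * ln a / (a / 2) powr (2/3) \<le> a powr (-1/2)"
      and e_ge: "C * (ln a / sqrt a) \<le> e" and e_le: "e \<le> 1/4"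
    define q where "q = a powr (-1/2)"
    have a1: "a \<ge> 1" using a by simp
    have q: "q = 1 / sqrt a"
      using a1 powr_minus_divide[of a "1/2"] by (simp add: q_def powr_half_sqrt)
    have log4: "log 2 (2 * a) \<le> 4 * ln a"
    proof -
      have "ln a / ln 2 \<le> ln a / (2/3)"
        using ln1 ln2_ge_two_thirds by (intro divide_left_mono) auto
      then have "log 2 a \<le> 3/2 * ln a"
        unfolding log_def by simp
      moreover have "log 2 (2 * a) = 1 + log 2 a"
        using a1 by (simp add: log_mult)
      ultimately show ?thesis
        using ln1 by linarith
    qed
    have log_small: "log 2 (2 * a) / (a / 2) powr (2/3) \<le> a powr (-1/2)"
      by (rule order_trans[OF divide_right_mono[OF log4] ln_small]) simp
    have "a * (C * (ln a / sqrt a)) \<le> a * e"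
      using e_ge a by (intro mult_left_mono) auto
    moreover have "a * (C * (ln a / sqrt a)) = C * ln a * (a / sqrt a)"
      by simp
    ultimately have ae: "C * ln a * sqrt a \<le> a * e"
      using a1 by (simp only: real_div_sqrt)
    have "1 * 1 \<le> C * ln a * sqrt a"
      using Cln a1 by (intro mult_mono) auto
    with ae have ae1: "1 \<le> a * e" by simp
    \<comment> \<open>Here the lower bound on \<open>e\<close> turns the logarithmic number of
      summands 1 into a term of the desired order.\<close>
    have ln_le: "ln a \<le> q / C * (a * e)"
      using ae assms a1 by (simp add: q field_simps)
    have ae4: "a * e \<le> a / 4" using mult_left_mono[OF e_le, of a] a1 by simp
    define l u where "l = a * (1 - e)" and "u = a * (1 + e)"
    have lu: "l - real d \<ge> a / 2" "u + real d \<le> 2 * a" "l \<ge> real d + 2" "l \<le> u"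
      "u - l + 2 * real d \<le> W * (a * e)" "u - l + 2 * real d \<ge> 0"
    proof -
      have eq: "l = a - a * e" "u = a + a * e"
        by (simp_all add: l_def u_def algebra_simps)
      show "l - real d \<ge> a / 2" "u + real d \<le> 2 * a" "l \<ge> real d + 2" "l \<le> u"
        "u - l + 2 * real d \<ge> 0"
        unfolding eq using ae4 a ae1 by linarith+
      \<comment> \<open>The window has length 2 a e, and 1 \<le> a e absorbs the widening by 2d;
        this explains \<open>W\<close>.\<close>
      have "2 * real d * 1 \<le> 2 * real d * (a * e)"
        using ae1 by (intro mult_left_mono) auto
      then show "u - l + 2 * real d \<le> W * (a * e)"
        by (simp add: l_def u_def W_def algebra_simps)
    qed
    have W0: "W \<ge> 0" by (simp add: W_def)
    have log0: "log 2 (2 * a) \<ge> 0" using a1 by simp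
    have half: "1 / (a / 2) powr (1/2) \<le> 2 * q"
    proof -
      have "sqrt 2 \<le> 2" by (rule real_le_lsqrt) auto
      then show ?thesis
        using a1 by (simp add: powr_half_sqrt q real_sqrt_divide divide_right_mono)
    qed
    have "real (card {x \<in> near_powers d. l \<le> real x \<and> real x \<le> u}) \<le> (2 * real d + 1) *
      ((u - l + 2 * real d) / (l - real d) powr (1/2) + 1 +
       log 2 (u + real d) * ((u - l + 2 * real d) / (l - real d) powr (2/3) + 1))"
      by (rule card_near_powers_le) fact+
    also have "\<dots> \<le> (2 * real d + 1) *
      (W * (a * e) / (a / 2) powr (1/2) + 1 +
       log 2 (2 * a) * (W * (a * e) / (a / 2) powr (2/3) + 1))"
      using lu a1 log0 W0 ae1
      by (intro mult_left_mono add_mono mult_mono frac_le powr_mono2 log_mono order_refl)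
        (auto intro!: add_nonneg_nonneg divide_nonneg_nonneg)
    \<comment> \<open>Regrouped so that the logarithm meets the denominator with exponent 2/3, as in
      \<open>log_small\<close>.\<close>
    also have "\<dots> = (2 * real d + 1) *
      (W * (a * e) * (1 / (a / 2) powr (1/2)) + 1 +
       (W * (a * e) * (log 2 (2 * a) / (a / 2) powr (2/3)) + log 2 (2 * a)))"
      by (simp add: algebra_simps)
    also have "\<dots> \<le> (2 * real d + 1) *
      (W * (a * e) * (2 * q) + q / C * (a * e) + (W * (a * e) * q + 4 * (q / C * (a * e))))"
      using half log_small W0 ae1 ln_le ln1 log4
      by (intro mult_left_mono add_mono) (auto simp: q_def)
    also have "\<dots> = K * q * (a * e)"
      by (simp add: K_def algebra_simps add_divide_distrib)
    finally show "real (card {x \<in> near_powers d. a * (1 - e) \<le> real x \<and> real x \<le> a * (1 + e)})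
      \<le> K * a powr (-1/2) * (a * e) \<and> 1 \<le> a * e"
      using ae1 by (simp add: l_def u_def q_def)
  qed
qed

section \<open>From the density bound to almost sure boundedness\<close>

lemma measure_uniform_count_space:
  assumes "finite S" "S \<noteq> {}"
  shows "measure (uniform_measure (count_space UNIV) S) T = real (card (S \<inter> T)) / real (card S)"
  using assms by (subst measure_uniform_measure) (auto simp: measure_count_space)

theorem theorem7p8:
  fixes A \<epsilon> :: "nat \<Rightarrow> real"
    and P :: "'a measure"
    and f :: "nat \<Rightarrow> 'a \<Rightarrow> nat"
    and d :: nat
  assumes A_pos: "\<And>n. n \<ge> 1 \<Longrightarrow> A n > 0"
    and A_lim: "filterlim A at_top sequentially"
    and A_sum: "summable (\<lambda>n. A (Suc n) powr (- 1 / 2))"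
    and eps_pos: "\<And>n. n \<ge> 1 \<Longrightarrow> \<epsilon> n > 0"
    and eps_lim: "\<epsilon> \<longlonglongrightarrow> 0"
    and eps_large: "\<exists>C>0. \<forall>\<^sub>F n in sequentially. \<epsilon> n \<ge> C * (ln (A n) / sqrt (A n))"
    and P_prob: "prob_space P"
    and f_meas: "\<And>n. n \<ge> 1 \<Longrightarrow> f n \<in> measurable P (count_space UNIV)"
    and f_unif: "\<And>n. n \<ge> 1 \<Longrightarrow>
      distr P (count_space UNIV) (f n) = uniform_measure (count_space UNIV) (sample_set A \<epsilon> n)"
  shows "AE \<omega> in P. \<exists>B::nat. \<forall>k\<ge>2. max_index (\<lambda>n. f n \<omega>) k d \<le> enat B"
proof -
  interpret prob_space P by fact
  define E where "E n = f n -` near_powers d \<inter> space P" for n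
  have E_sets: "E n \<in> events" if "n \<ge> 1" for n
    unfolding E_def using f_meas[OF that] by (rule measurable_sets) simp
  have prob_E: "prob (E n) =
      measure (uniform_measure (count_space UNIV) (sample_set A \<epsilon> n)) (near_powers d)"
    if "n \<ge> 1" for n
    unfolding E_def f_unif[OF that, symmetric] using f_meas[OF that] by (simp add: measure_distr)
  obtain C where C: "C > 0" "\<forall>\<^sub>F n in sequentially. \<epsilon> n \<ge> C * (ln (A n) / sqrt (A n))"
    using eps_large by blast
  obtain K where K: "\<forall>\<^sub>F a in at_top. \<forall>e. C * (ln a / sqrt a) \<le> e \<longrightarrow> e \<le> 1/4 \<longrightarrow>
    real (card {x \<in> near_powers d. a * (1 - e) \<le> real x \<and> real x \<le> a * (1 + e)})
      \<le> K * a powr (-1/2) * (a * e) \<and> 1 \<le> a * e"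
    using near_powers_density[OF C(1)] by blast
  have eps_small: "\<forall>\<^sub>F n in sequentially. \<epsilon> n < 1/4"
    by (rule order_tendstoD[OF eps_lim]) simp
  have bound: "\<forall>\<^sub>F n in sequentially. prob (E n) \<le> K * A n powr (-1/2)"
    using eventually_compose_filterlim[OF K A_lim] C(2) eps_small eventually_ge_at_top[of 1]
  proof eventually_elim
    case (elim n)
    let ?S = "sample_set A \<epsilon> n" and ?a = "A n * \<epsilon> n"
    have num: "real (card {x \<in> near_powers d. A n * (1 - \<epsilon> n) \<le> real x \<and> real x \<le> A n * (1 + \<epsilon> n)})
      \<le> K * A n powr (-1/2) * ?a" (is "real (card ?T) \<le> _") and ae1: "1 \<le> ?a"
      using elim by auto
    \<comment> \<open>The left side is 2 \<open>?a\<close> - 1, which is at least \<open>?a\<close>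
      because 1 \<le> \<open>?a\<close>.\<close>
    have "A n * (1 + \<epsilon> n) - A n * (1 - \<epsilon> n) - 1 \<le> real (card ?S)"
      unfolding sample_set_def using A_pos[OF elim(4)] elim(3)
      by (intro card_nat_between_ge) simp
    then have den: "?a \<le> real (card ?S)"
      using ae1 by (simp add: algebra_simps)
    then have "?S \<noteq> {}" using ae1 by auto
    then have "prob (E n) = real (card (?S \<inter> near_powers d)) / real (card ?S)"
      unfolding prob_E[OF elim(4)] by (intro measure_uniform_count_space finite_sample_set)
    also have "\<dots> \<le> real (card (?S \<inter> near_powers d)) / ?a"
      using den ae1 by (intro divide_left_mono) auto
    also have "\<dots> \<le> real (card ?T) / ?a"
    proof (intro divide_right_mono of_nat_mono card_mono)
      show "finite ?T"
        by (rule finite_subset[of _ "{..nat \<lceil>A n * (1 + \<epsilon> n)\<rceil>}"]) (auto, linarith)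
    qed (use ae1 in \<open>auto simp: sample_set_def\<close>)
    also have "\<dots> \<le> K * A n powr (-1/2)"
      using num ae1 by (subst pos_divide_le_eq) auto
    finally show ?case .
  qed
  \<comment> \<open>The shift by \<open>Suc\<close> skips index 0, about which nothing is
    assumed.\<close>
  have "summable (\<lambda>n. prob (E (Suc n)))"
  proof (rule summable_comparison_test_ev)
    show "\<forall>\<^sub>F n in sequentially. norm (prob (E (Suc n))) \<le> K * A (Suc n) powr (-1/2)"
      using eventually_compose_filterlim[OF bound filterlim_Suc] by simp
    show "summable (\<lambda>n. K * A (Suc n) powr (-1/2))"
      using A_sum by (intro summable_mult) simp
  qed
  then have "AE \<omega> in P. \<forall>\<^sub>F n in sequentially. \<omega> \<in> space P - E (Suc n)"
    using E_sets by (intro borel_cantelli_AE1) (auto simp: emeasure_eq_measure)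
  then show ?thesis
  proof eventually_elim
    case (elim \<omega>)
    then obtain N where N: "\<And>n. n \<ge> N \<Longrightarrow> \<omega> \<in> space P - E (Suc n)"
      by (auto simp: eventually_sequentially)
    \<comment> \<open>\<open>N\<close> was obtained from \<omega> alone, before \<open>k\<close> is
      fixed.\<close>
    have "max_index (\<lambda>n. f n \<omega>) k d \<le> enat N" if "k \<ge> 2" for k
    proof (rule max_index_le)
      fix n assume n: "n \<ge> 1" "power_dist (\<lambda>n. f n \<omega>) k n \<le> d"
      \<comment> \<open>The instance of \<open>N\<close> at \<open>N\<close> itself only supplies
        that \<omega> lies in \<open>space P\<close>.\<close>
      have "\<omega> \<in> E n"
        using n(2) that N[of N] by (auto simp: power_dist_le_iff E_def near_powers_def)
      \<comment> \<open>If n > N, then n - 1 \<ge> N, so \<omega> would avoid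
        \<open>E n\<close>.\<close>
      with N[of "n - 1"] n(1) show "n \<le> N"
        by (cases "N \<le> n - 1") auto
    qed
    then show ?case by blast
  qed
qed

end
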